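(* Let $d\ge 1$ and let $\mathbf{s}=(s_1,\ldots,s_d)$ be a strictly increasing sequence of positive integers. Then $\mathbf{P}_d^{(\mathbf{s})}$ is translation equivalent to a Fano polytope if and only if $s_1=2$ and $s_{i+1}\le 2s_i$ for all $1\le i\le d-1$. Moreover, if $\mathbf{P}_d^{(\mathbf{s})}$ is translation equivalent to a Fano polytope, then the unique interior lattice point of $\mathbf{P}_d^{(\mathbf{s})}$ is $(x_d,x_{d-1},\ldots,x_1)^T=(s_d-1,s_{d-1}-1,\ldots,s_2-1,s_1-1)^T$.
   Context: For a sequence of positive integers $\mathbf{s}=(s_1,\ldots,s_d)$, the $\mathbf{s}$-lecture hall polytope is $\mathbf{P}_d^{(\mathbf{s})}=\{\mathbf{x}\in\mathbb{R}^d : 0\le \frac{x_1}{s_1}\le\frac{x_2}{s_2}\le\cdots\le\frac{x_d}{s_d}\le 1\}$, a $d$-dimensional lattice polytope. Points are written as column vectors with $x_d$ as first entry and $x_1$ as last entry. A $d$-dimensional lattice polytope $\mathcal{P}\subset\mathbb{R}^d$ is Fano if $(\mathcal{P}\setminus\partial\mathcal{P})\cap\mathbb{Z}^d=\{\mathbf{0}\}$. Two lattice polytopes are translation equivalent if one is the translate of the other by a vector in $\mathbb{Z}^d$. *)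

theory Defs
  imports "HOL-Analysis.Analysis"
begin

text \<open>
  Throughout, \<open>d = CARD('n)\<close>. Sequences and coordinates are indexed by \<open>1, \<dots>, d\<close>
  (as functions on the natural numbers whose values outside this range are irrelevant), and a point
  is the column vector with \<open>x\<^sub>d\<close> as first and \<open>x\<^sub>1\<close> as last entry. The rows are
  the elements of \<open>'n\<close> in increasing order, so row \<open>j\<close> is preceded by
  \<open>card {..<j}\<close> rows and contains the coordinate with index \<open>d - card {..<j}\<close>.
\<close>

definition column_point :: "(nat \<Rightarrow> real) \<Rightarrow> real ^ 'n::{finite,linorder}" where
  "column_point x = (\<chi> j. x (CARD('n) - card {..<j}))"

definition lecture_hall_polytope :: "(nat \<Rightarrow> nat) \<Rightarrow> (real ^ 'n::{finite,linorder}) set" where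
  "lecture_hall_polytope s =
     {column_point x | x.
        0 \<le> x 1 / real (s 1) \<and>
        (\<forall>i\<in>{1..<CARD('n)}. x i / real (s i) \<le> x (i + 1) / real (s (i + 1))) \<and>
        x CARD('n) / real (s CARD('n)) \<le> 1}"

definition integer_lattice :: "(real ^ 'n) set" where
  "integer_lattice = {z. \<forall>j. z $ j \<in> \<int>}"

definition lattice_polytope :: "(real ^ 'n) set \<Rightarrow> bool" where
  "lattice_polytope P \<longleftrightarrow> (\<exists>V. finite V \<and> V \<subseteq> integer_lattice \<and> P = convex hull V)"

definition fano_polytope :: "(real ^ 'n) set \<Rightarrow> bool" where
  "fano_polytope P \<longleftrightarrow>
     lattice_polytope P \<and> aff_dim P = int CARD('n) \<and>
     (P - frontier P) \<inter> integer_lattice = {0}"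

definition translation_equivalent :: "(real ^ 'n) set \<Rightarrow> (real ^ 'n) set \<Rightarrow> bool" where
  "translation_equivalent P Q \<longleftrightarrow> (\<exists>v\<in>integer_lattice. Q = (\<lambda>x. v + x) ` P)"

end

(*
  P minus its frontier is its interior, which is cut out by the strict inequalities
  0 < x_1/s_1 < ... < x_d/s_d < 1, and P is Fano up to translation iff its interior contains exactly
  one lattice point. If s_1 >= 2, the point s - 1 is interior because s is strictly increasing. Its
  first coordinate can be lowered by one if s_1 > 2, and its coordinate x_(i+1) can be if
  s_(i+1) > 2 s_i, which gives a second lattice point. Conversely, if s_1 = 2 and s_(i+1) <= 2 s_i,
  then x_1 = 1, and x_i = s_i - 1 forces s_(i+1) - 2 < x_(i+1) < s_(i+1).
*)
theory Submission
  imports Defs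
begin

section \<open>Coordinates\<close>

text \<open>The order-reversing index map inside \<open>column_point\<close>, isolated so that its
  bijectivity onto \<open>{1..CARD('n)}\<close> can be proved once.\<close>

definition row_index :: "'n::{finite,linorder} \<Rightarrow> nat" where
  "row_index j = CARD('n) - card {..<j}"

definition index_row :: "nat \<Rightarrow> 'n::{finite,linorder}" where
  "index_row = inv_into UNIV row_index"

text \<open>Inverse to \<open>column_point\<close>: it recovers x_i from the vector. It is
  meaningful only for i in \<open>{1..CARD('n)}\<close>, since \<open>index_row\<close> is arbitrary
  elsewhere.\<close>

definition coordinate :: "real ^ 'n::{finite,linorder} \<Rightarrow> nat \<Rightarrow> real" where
  "coordinate z i = z $ index_row i"

lemma card_lessThan_less: "card {..<j} < CARD('n)" for j :: "'n::{finite,linorder}"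
  by (rule psubset_card_mono) auto

lemma inj_row_index: "inj (row_index :: 'n::{finite,linorder} \<Rightarrow> nat)"
proof (rule linorder_injI)
  fix i j :: 'n assume "i < j"
  then have "card {..<i} < card {..<j}"
    by (intro psubset_card_mono) auto
  then show "row_index i \<noteq> row_index j"
    using card_lessThan_less[of j] by (simp add: row_index_def)
qed

text \<open>An injective map into a finite set of the same cardinality is onto.\<close>

lemma range_row_index: "range (row_index :: 'n::{finite,linorder} \<Rightarrow> nat) = {1..CARD('n)}"
proof (rule card_subset_eq)
  show "range (row_index :: 'n \<Rightarrow> nat) \<subseteq> {1..CARD('n)}"
    using card_lessThan_less by (force simp: row_index_def Suc_le_eq)
qed (simp_all add: card_image inj_row_index)

lemma row_index_bounds: "row_index (j :: 'n::{finite,linorder}) \<in> {1..CARD('n)}"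
  unfolding range_row_index[symmetric] by simp

lemma row_index_index_row:
  "i \<in> {1..CARD('n)} \<Longrightarrow> row_index (index_row i :: 'n::{finite,linorder}) = i"
  unfolding index_row_def by (rule f_inv_into_f) (simp add: range_row_index)

lemma index_row_row_index: "index_row (row_index j) = j"
  unfolding index_row_def by (simp add: inj_row_index)

lemma column_point_nth: "column_point x $ j = x (row_index j)"
  by (simp add: column_point_def row_index_def)

lemma coordinate_column_point:
  "i \<in> {1..CARD('n)} \<Longrightarrow> coordinate (column_point x :: real ^ 'n::{finite,linorder}) i = x i"
  by (simp only: coordinate_def column_point_nth row_index_index_row)

lemma column_point_coordinate: "column_point (coordinate z) = z"
  by (simp add: vec_eq_iff column_point_nth coordinate_def index_row_row_index)

lemma column_point_eq_iff:
  "column_point x = (column_point y :: real ^ 'n::{finite,linorder}) \<longleftrightarrow>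
     (\<forall>i\<in>{1..CARD('n)}. x i = y i)"
  unfolding vec_eq_iff column_point_nth range_row_index[symmetric] by blast

lemma column_point_in_integer_lattice_iff:
  "(column_point x :: real ^ 'n::{finite,linorder}) \<in> integer_lattice \<longleftrightarrow>
     (\<forall>i\<in>{1..CARD('n)}. x i \<in> \<int>)"
  unfolding integer_lattice_def mem_Collect_eq column_point_nth range_row_index[symmetric] by blast

text \<open>Every vector comes from its own coordinate sequence, so the existential over sequences
  disappears and the polytope becomes an intersection of half-spaces.\<close>

lemma lecture_hall_polytope_eq:
  "lecture_hall_polytope s = {z :: real ^ 'n::{finite,linorder}.
     0 \<le> coordinate z 1 / s 1 \<and>
     (\<forall>i\<in>{1..<CARD('n)}. coordinate z i / s i \<le> coordinate z (i + 1) / s (i + 1)) \<and>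
     coordinate z CARD('n) / s CARD('n) \<le> 1}" (is "?L = {z. ?R (coordinate z)}")
proof -
  have 1: "1 \<in> {1..CARD('n)}" "CARD('n) \<in> {1..CARD('n)}"
    by (simp_all add: Suc_le_eq)
  have "?R (coordinate (column_point x :: real ^ 'n::_)) \<longleftrightarrow> ?R x" for x
    using 1 by (simp add: coordinate_column_point)
  then show ?thesis
    unfolding lecture_hall_polytope_def by (auto, metis column_point_coordinate)
qed

section \<open>The interior of a lecture hall polytope\<close>

text \<open>The strict inequalities cut out an open subset of the polytope. Conversely, each
  defining inequality has a nonzero normal vector, because the \<open>s i\<close> are positive, and
  so is strict on the interior.\<close>

lemma interior_lecture_hall_polytope:
  fixes s :: "nat \<Rightarrow> nat"
  assumes pos: "\<forall>i\<in>{1..CARD('n)}. 0 < s i"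
  shows "interior (lecture_hall_polytope s) = {z :: real ^ 'n::{finite,linorder}.
     0 < coordinate z 1 / s 1 \<and>
     (\<forall>i\<in>{1..<CARD('n)}. coordinate z i / s i < coordinate z (i + 1) / s (i + 1)) \<and>
     coordinate z CARD('n) / s CARD('n) < 1}" (is "interior ?P = ?S")
proof
  have "?S = {z. 0 < coordinate z 1 / s 1} \<inter>
     (\<Inter>i\<in>{1..<CARD('n)}. {z. coordinate z i / s i < coordinate z (i + 1) / s (i + 1)}) \<inter>
     {z. coordinate z CARD('n) / s CARD('n) < 1}"
    by auto
  moreover have "open \<dots>"
    unfolding coordinate_def divide_inverse
    by (intro open_Int open_INT finite_atLeastLessThan ballI open_Collect_less continuous_intros)
  ultimately have "open ?S"
    by simp
  moreover have "?S \<subseteq> ?P"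
    by (auto simp: lecture_hall_polytope_eq intro: less_imp_le)
  ultimately show "?S \<subseteq> interior ?P"
    by (rule interior_maximal[rotated])
next
  have 1: "1 \<in> {1..CARD('n)}" "CARD('n) \<in> {1..CARD('n)}"
    by (simp_all add: Suc_le_eq)
  \<comment> \<open>Interior is monotone, and the interior of a closed half-space is the open
    one.\<close>
  have halfspace: "a \<bullet> z < b" if "z \<in> interior ?P" "a \<noteq> 0" "\<And>z. z \<in> ?P \<Longrightarrow> a \<bullet> z \<le> b"
    for a z :: "real ^ 'n::_" and b
    using interior_mono[of ?P "{z. a \<bullet> z \<le> b}"] that by (auto simp: interior_halfspace_le)
  \<comment> \<open>\<open>a i\<close> represents the functional x_i / s_i; the facet normals are
    \<open>- a 1\<close>, \<open>a i - a (i + 1)\<close> and \<open>a CARD('n)\<close>.\<close>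
  define a :: "nat \<Rightarrow> real ^ 'n::_" where "a i = axis (index_row i) (1 / s i)" for i
  have a_inner: "a i \<bullet> z = coordinate z i / s i" for i z
    by (simp add: a_def coordinate_def inner_axis')
  have a_nth: "a i $ index_row i = 1 / s i" "i \<noteq> k \<Longrightarrow> a k $ index_row i = 0"
    if "i \<in> {1..CARD('n)}" "k \<in> {1..CARD('n)}" for i k
    using that row_index_index_row[where 'n='n, of i] row_index_index_row[where 'n='n, of k]
    by (auto simp: a_def axis_def)
  have a_nonzero: "a i \<noteq> 0" if "i \<in> {1..CARD('n)}" for i
    using a_nth(1)[OF that that] bspec[OF pos that] by auto
  show "interior ?P \<subseteq> ?S"
  proof
    fix z assume z: "z \<in> interior ?P"
    have "- a 1 \<bullet> z < 0"
      using a_nonzero[OF 1(1)]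
      by (intro halfspace[OF z]) (auto simp: a_inner lecture_hall_polytope_eq)
    moreover have "a CARD('n) \<bullet> z < 1"
      using a_nonzero[OF 1(2)]
      by (intro halfspace[OF z]) (auto simp: a_inner lecture_hall_polytope_eq)
    moreover have "(a i - a (i + 1)) \<bullet> z < 0" if i: "i \<in> {1..<CARD('n)}" for i
    proof (rule halfspace[OF z])
      have "(a i - a (i + 1)) $ index_row i = 1 / s i"
        using a_nth[of i i] a_nth[of i "i + 1"] i by simp
      then show "a i - a (i + 1) \<noteq> 0"
        using bspec[OF pos, of i] i by auto
    qed (use i in \<open>auto simp: a_inner inner_diff_left lecture_hall_polytope_eq\<close>)
    ultimately show "z \<in> ?S"
      by (auto simp: a_inner inner_diff_left)
  qed
qed

section \<open>Vertices\<close>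

lemma convex_lecture_hall_polytope:
  "convex (lecture_hall_polytope s :: (real ^ 'n::{finite,linorder}) set)"
proof -
  have "lecture_hall_polytope s = {z :: real ^ 'n::_. 0 \<le> coordinate z 1 / s 1} \<inter>
     (\<Inter>i\<in>{1..<CARD('n)}. {z. coordinate z i / s i \<le> coordinate z (i + 1) / s (i + 1)}) \<inter>
     {z. coordinate z CARD('n) / s CARD('n) \<le> 1}"
    by (auto simp: lecture_hall_polytope_eq)
  moreover have "convex {z :: real ^ 'n::_. 0 \<le> coordinate z i / s i}"
    "convex {z :: real ^ 'n::_. coordinate z i / s i \<le> 1}"
    "convex {z :: real ^ 'n::_. coordinate z i / s i \<le> coordinate z k / s k}" for i k
  proof -
    define a :: "nat \<Rightarrow> real ^ 'n::_" where "a i = axis (index_row i) (1 / s i)" for i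
    have a_inner: "coordinate z i / s i = a i \<bullet> z" for i z
      by (simp add: a_def coordinate_def inner_axis')
    show "convex {z :: real ^ 'n::_. 0 \<le> coordinate z i / s i}"
      "convex {z :: real ^ 'n::_. coordinate z i / s i \<le> 1}"
      unfolding a_inner using convex_halfspace_ge[of 0 "a i"] convex_halfspace_le by auto
    show "convex {z :: real ^ 'n::_. coordinate z i / s i \<le> coordinate z k / s k}"
      unfolding a_inner using convex_halfspace_le[of "a i - a k" 0] by (simp add: inner_diff_left)
  qed
  ultimately show ?thesis
    by (auto intro!: convex_Int convex_INT)
qed

text \<open>The polytope is a simplex: vertex k has x_i = 0 for i \<le> k and x_i = s_i beyond. The
  barycentric coordinates of a point are the successive increments of the chain 0 \<le> x_1/s_1
  \<le> ... \<le> x_d/s_d \<le> 1.\<close>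

lemma lecture_hall_polytope_eq_convex_hull:
  fixes s :: "nat \<Rightarrow> nat"
  assumes pos: "\<forall>i\<in>{1..CARD('n)}. 0 < s i"
  shows "(lecture_hall_polytope s :: (real ^ 'n::{finite,linorder}) set) =
    convex hull ((\<lambda>k. column_point (\<lambda>i. if k < i then real (s i) else 0)) ` {..CARD('n)})"
    (is "?P = convex hull (?w ` _)")
proof
  have 1: "1 \<in> {1..CARD('n)}" "CARD('n) \<in> {1..CARD('n)}"
    by (simp_all add: Suc_le_eq)
  have "?w k \<in> ?P" for k
    unfolding lecture_hall_polytope_def using pos 1 by fastforce
  then show "convex hull (?w ` {..CARD('n)}) \<subseteq> ?P"
    by (intro hull_minimal convex_lecture_hall_polytope) auto
  show "?P \<subseteq> convex hull (?w ` {..CARD('n)})"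
  proof
    fix z assume z: "z \<in> ?P"
    \<comment> \<open>Padding the chain with 0 at the start and 1 at the end gives d + 1 increments
      with sum 1, one for each vertex.\<close>
    define y where "y i = (if i = 0 then 0 else if i > CARD('n) then 1 else coordinate z i / s i)" for i
    have step: "y k \<le> y (Suc k)" if k: "k \<le> CARD('n)" for k
    proof -
      consider "k = 0" | "k \<in> {1..<CARD('n)}" | "k = CARD('n)" "k > 0"
        using k by fastforce
      then show ?thesis
        using z by cases (auto simp: lecture_hall_polytope_eq y_def Suc_le_eq)
    qed
    have "(\<Sum>k\<le>CARD('n). (y (Suc k) - y k) *\<^sub>R ?w k) \<in> convex hull (?w ` {..CARD('n)})"
    proof (rule convex_sum)
      show "(\<Sum>k\<le>CARD('n). y (Suc k) - y k) = 1"
        using sum_lessThan_telescope[of y "Suc CARD('n)"] by (simp add: y_def lessThan_Suc_atMost)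
    qed (use step in \<open>auto intro: hull_inc\<close>)
    moreover have "(\<Sum>k\<le>CARD('n). (y (Suc k) - y k) *\<^sub>R ?w k) = z"
      unfolding vec_eq_iff
    proof
      fix j :: 'n
      define i where "i = (row_index j :: nat)"
      have i: "i \<in> {1..CARD('n)}"
        unfolding i_def by (rule row_index_bounds)
      have "(\<Sum>k\<le>CARD('n). (y (Suc k) - y k) *\<^sub>R ?w k) $ j =
          (\<Sum>k\<le>CARD('n). if k < i then (y (Suc k) - y k) * s i else 0)"
        unfolding sum_component by (intro sum.cong) (auto simp: column_point_nth i_def)
      \<comment> \<open>Only the vertices with k < i contribute to x_i, and their weights telescope
        to \<open>y i\<close>.\<close>
      also have "\<dots> = (\<Sum>k<i. (y (Suc k) - y k) * s i)"
        using i by (intro sum.mono_neutral_cong_right) auto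
      also have "\<dots> = y i * s i"
        unfolding sum_distrib_right[symmetric] sum_lessThan_telescope by (simp add: y_def)
      also have "\<dots> = z $ j"
        using i bspec[OF pos i] by (simp add: y_def coordinate_def) (simp add: i_def index_row_row_index)
      finally show "(\<Sum>k\<le>CARD('n). (y (Suc k) - y k) *\<^sub>R ?w k) $ j = z $ j" .
    qed
    ultimately show "z \<in> convex hull (?w ` {..CARD('n)})"
      by simp
  qed
qed

lemma lattice_polytope_lecture_hall:
  assumes "\<forall>i\<in>{1..CARD('n)}. 0 < s i"
  shows "lattice_polytope (lecture_hall_polytope s :: (real ^ 'n::{finite,linorder}) set)"
  unfolding lattice_polytope_def lecture_hall_polytope_eq_convex_hull[OF assms]
  by (rule exI, rule conjI[OF _ conjI[OF _ refl]]) (auto simp: column_point_in_integer_lattice_iff)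

section \<open>Translates\<close>

lemma Diff_frontier: "S - frontier S = interior S"
  using interior_subset closure_subset by (fastforce simp: frontier_def)

lemma integer_lattice_add: "x \<in> integer_lattice \<Longrightarrow> y \<in> integer_lattice \<Longrightarrow> x + y \<in> integer_lattice"
  and integer_lattice_uminus: "x \<in> integer_lattice \<Longrightarrow> - x \<in> integer_lattice"
  by (auto simp: integer_lattice_def)

lemma integer_lattice_translation:
  assumes "v \<in> integer_lattice"
  shows "(\<lambda>x. v + x) ` integer_lattice = integer_lattice"
proof (intro equalityI subsetI)
  fix x :: "real ^ 'a" assume "x \<in> integer_lattice"
  with assms show "x \<in> (\<lambda>x. v + x) ` integer_lattice"
    by (intro image_eqI[of _ _ "- v + x"] integer_lattice_add integer_lattice_uminus) auto
qed (use assms in \<open>auto intro: integer_lattice_add\<close>)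

lemma interior_lattice_points_translation:
  "v \<in> integer_lattice \<Longrightarrow>
     interior ((\<lambda>x. v + x) ` P) \<inter> integer_lattice = (\<lambda>x. v + x) ` (interior P \<inter> integer_lattice)"
  by (simp add: interior_translation image_Int integer_lattice_translation)

lemma lattice_polytope_translation:
  assumes "v \<in> integer_lattice" "lattice_polytope P"
  shows "lattice_polytope ((\<lambda>x. v + x) ` P)"
proof -
  obtain V where "finite V" "V \<subseteq> integer_lattice" "P = convex hull V"
    using assms(2) unfolding lattice_polytope_def by blast
  then show ?thesis
    unfolding lattice_polytope_def using assms(1)
    by (intro exI[of _ "(\<lambda>x. v + x) ` V"])
      (auto simp: convex_hull_translation intro: integer_lattice_add)
qed

text \<open>A lattice translation preserves lattice polytopes and carries interior lattice points to
  interior lattice points, so a single such point p can be moved to the origin by - p.\<close>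

lemma translation_equivalent_fano_iff:
  assumes "lattice_polytope P"
  shows "(\<exists>Q. fano_polytope Q \<and> translation_equivalent P Q) \<longleftrightarrow>
    (\<exists>p. interior P \<inter> integer_lattice = {p})"
proof
  assume "\<exists>Q. fano_polytope Q \<and> translation_equivalent P Q"
  then obtain v where v: "v \<in> integer_lattice" "fano_polytope ((\<lambda>x. v + x) ` P)"
    unfolding translation_equivalent_def by blast
  then have "(\<lambda>x. v + x) ` (interior P \<inter> integer_lattice) = {0}"
    unfolding fano_polytope_def Diff_frontier interior_lattice_points_translation[OF v(1)] by blast
  then show "\<exists>p. interior P \<inter> integer_lattice = {p}"
    by (metis image_empty inj_image_eq_iff image_insert inj_on_add add.right_inverse)
next
  assume "\<exists>p. interior P \<inter> integer_lattice = {p}"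
  then obtain p where p: "interior P \<inter> integer_lattice = {p}" ..
  let ?Q = "(\<lambda>x. - p + x) ` P"
  have v: "- p \<in> integer_lattice"
    using p by (auto intro: integer_lattice_uminus)
  \<comment> \<open>Full dimension follows from p lying in the interior.\<close>
  have "aff_dim ?Q = int CARD('a)"
    unfolding aff_dim_translation_eq using p by (subst aff_dim_nonempty_interior) auto
  then have "fano_polytope ?Q"
    unfolding fano_polytope_def Diff_frontier interior_lattice_points_translation[OF v] p
    using lattice_polytope_translation[OF v assms] by simp
  then show "\<exists>Q. fano_polytope Q \<and> translation_equivalent P Q"
    unfolding translation_equivalent_def using v by blast
qed

section \<open>Interior lattice points\<close>

text \<open>The interior in terms of sequences, with the dimension as a number, so that the
  remaining argument is pure arithmetic.\<close>

definition interior_lecture_hall :: "nat \<Rightarrow> (nat \<Rightarrow> nat) \<Rightarrow> (nat \<Rightarrow> real) \<Rightarrow> bool" where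
  "interior_lecture_hall d s x \<longleftrightarrow>
     0 < x 1 / s 1 \<and> (\<forall>i\<in>{1..<d}. x i / s i < x (i + 1) / s (i + 1)) \<and> x d / s d < 1"

text \<open>The quotients increase towards the last one, which is below 1; the induction runs
  downwards from d.\<close>

lemma interior_lecture_hall_bounds:
  assumes "interior_lecture_hall d s x" "i \<in> {1..d}"
  shows "x i / s i < 1"
proof -
  have "i \<le> d" "1 \<le> i" using assms(2) by auto
  then show ?thesis
  proof (induction rule: inc_induct)
    case base
    then show ?case using assms(1) by (simp add: interior_lecture_hall_def)
  next
    case (step n)
    then have "x n / s n < x (n + 1) / s (n + 1)"
      using assms(1) by (simp add: interior_lecture_hall_def)
    then show ?case using step by simp
  qed
qed

text \<open>The quotients are 1 - 1/s_i, which increase strictly with s_i and stay below 1; s_1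
  \<ge> 2 makes the first one positive.\<close>

lemma interior_lecture_hall_pred:
  assumes "\<And>i. i \<in> {1..d} \<Longrightarrow> 0 < s i" "strict_mono_on {1..d} s" "d \<ge> 1" "s 1 \<ge> 2"
  shows "interior_lecture_hall d s (\<lambda>i. real (s i) - 1)"
proof -
  have "(real (s i) - 1) / s i < (real (s (i + 1)) - 1) / s (i + 1)" if "i \<in> {1..<d}" for i
  proof -
    have "0 < s i" "s i < s (i + 1)"
      using that assms by (auto simp: strict_mono_on_def)
    then show ?thesis
      by (simp add: field_simps)
  qed
  then show ?thesis
    using assms(1)[of d] assms(3,4)
    by (auto simp: interior_lecture_hall_def)
qed

text \<open>Lowering the coordinate with index \<open>k\<close> stays in the interior as soon as the
  inequality to its left survives, since the one to its right only gets weaker.\<close>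

lemma interior_lecture_hall_lower:
  assumes pos: "\<And>i. i \<in> {1..d} \<Longrightarrow> 0 < s i" and x: "interior_lecture_hall d s x" "k \<in> {1..d}"
    and first: "k = 1 \<Longrightarrow> 0 < (x k - 1) / s k"
    and left: "k > 1 \<Longrightarrow> x (k - 1) / s (k - 1) < (x k - 1) / s k"
  shows "interior_lecture_hall d s (x(k := x k - 1))"
proof -
  have lower: "(x(k := x k - 1)) i / s i \<le> x i / s i" for i
    by (simp add: divide_right_mono)
  have "(x(k := x k - 1)) i / s i < (x(k := x k - 1)) (i + 1) / s (i + 1)" if "i \<in> {1..<d}" for i
  proof (cases "i + 1 = k")
    case True
    then show ?thesis using left that by auto
  next
    case False
    have "x i / s i < x (i + 1) / s (i + 1)"
      using x(1) that by (simp add: interior_lecture_hall_def)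
    then show ?thesis using lower[of i] False by simp
  qed
  then show ?thesis
    using x first lower[of d] unfolding interior_lecture_hall_def by auto
qed

text \<open>Any violated condition leaves room to lower one coordinate of s - 1, which yields a
  second interior lattice point. Uniqueness is expressed on \<open>{1..d}\<close> only, as sequences
  are arbitrary elsewhere.\<close>

lemma interior_lecture_hall_unique_imp:
  assumes pos: "\<And>i. i \<in> {1..d} \<Longrightarrow> 0 < s i" and mono: "strict_mono_on {1..d} s" and d: "d \<ge> 1"
    and x: "interior_lecture_hall d s x" "\<And>i. i \<in> {1..d} \<Longrightarrow> x i \<in> \<int>"
    and unique: "\<And>y i. interior_lecture_hall d s y \<Longrightarrow> (\<And>i. i \<in> {1..d} \<Longrightarrow> y i \<in> \<int>) \<Longrightarrow>
      i \<in> {1..d} \<Longrightarrow> y i = x i"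
  shows "s 1 = 2 \<and> (\<forall>i\<in>{1..d - 1}. s (i + 1) \<le> 2 * s i)"
proof -
  let ?p = "\<lambda>i. real (s i) - 1"
  \<comment> \<open>An integer strictly between 0 and s_1 forces s_1 \<ge> 2, which places s - 1 in
    the interior.\<close>
  have "0 < x 1 / s 1" "x 1 / s 1 < 1"
    using x interior_lecture_hall_bounds[OF x(1), of 1] d by (auto simp: interior_lecture_hall_def)
  moreover have "0 < s 1"
    using pos d by simp
  ultimately have "0 < x 1" "x 1 < s 1"
    by (simp_all add: field_simps)
  moreover obtain m where "x 1 = of_int m"
    using x(2)[of 1] d by (auto elim: Ints_cases)
  ultimately have s1: "s 1 \<ge> 2"
    by simp
  note p = interior_lecture_hall_pred[OF pos mono d s1]
  \<comment> \<open>By uniqueness both s - 1 and its lowered version would agree with x at k, though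
    they differ there by 1.\<close>
  have not_lower: False if k: "k \<in> {1..d}" and "interior_lecture_hall d s (?p(k := ?p k - 1))" for k
  proof -
    have "(?p(k := ?p k - 1)) k = x k"
      using that by (intro unique[of "?p(k := ?p k - 1)"]) auto
    moreover have "?p k = x k"
      using k p by (intro unique[of ?p]) auto
    ultimately show False by simp
  qed
  have "s 1 = 2"
  proof (rule ccontr)
    assume "s 1 \<noteq> 2"
    then have "s 1 > 2" using s1 by simp
    then show False
      using d by (intro not_lower[of 1] interior_lecture_hall_lower pos p) auto
  qed
  moreover have "s (i + 1) \<le> 2 * s i" if i: "i \<in> {1..d - 1}" for i
  proof (rule ccontr)
    assume "\<not> s (i + 1) \<le> 2 * s i"
    then have "2 * real (s i) < s (i + 1)"
      by linarith
    moreover have "0 < s i" "0 < s (i + 1)"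
      using i pos by auto
    \<comment> \<open>Equivalent to 2/s_(i+1) < 1/s_i, the negated growth bound.\<close>
    ultimately have "?p i / s i < (?p (i + 1) - 1) / s (i + 1)"
      by (simp add: field_simps)
    then show False
      using i by (intro not_lower[of "i + 1"] interior_lecture_hall_lower pos p) auto
  qed
  ultimately show ?thesis by blast
qed

text \<open>Induction on the index: the value s_n - 1 at n gives x_(n+1) > s_(n+1) - 2, while
  x_(n+1) < s_(n+1) always holds, so integrality leaves one value.\<close>

lemma interior_lecture_hall_unique:
  assumes pos: "\<And>i. i \<in> {1..d} \<Longrightarrow> 0 < s i"
    and s: "s 1 = 2" "\<forall>i\<in>{1..d - 1}. s (i + 1) \<le> 2 * s i"
    and x: "interior_lecture_hall d s x" "\<And>i. i \<in> {1..d} \<Longrightarrow> x i \<in> \<int>"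
    and i: "i \<in> {1..d}"
  shows "x i = real (s i) - 1"
proof -
  have lt: "x i < s i" if "i \<in> {1..d}" for i
    using interior_lecture_hall_bounds[OF x(1) that] pos[OF that] by (simp add: field_simps)
  have squeeze: "x i = real (s i) - 1" if "i \<in> {1..d}" "real (s i) - 2 < x i" for i
  proof -
    have "x i \<in> \<int>"
      using that(1) by (rule x(2))
    then obtain m where "x i = of_int m"
      by (auto elim: Ints_cases)
    moreover from this have "m < int (s i)" "int (s i) - 2 < m"
      using lt[OF that(1)] that(2) by linarith+
    then have "m = int (s i) - 1"
      by linarith
    ultimately show ?thesis
      by simp
  qed
  have "1 \<le> i" "i \<le> d" using i by auto
  then show ?thesis
  proof (induction rule: dec_induct)
    case base
    have "0 < x 1 / s 1"
      using x(1) by (simp add: interior_lecture_hall_def)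
    \<comment> \<open>As s_1 = 2, positivity of x_1 is exactly the lower bound s_1 - 2 <
      x_1.\<close>
    then show ?case
      using base s(1) by (intro squeeze) auto
  next
    case (step n)
    have n: "0 < real (s n)" "0 < real (s (n + 1))"
      using step pos by auto
    have le: "real (s (n + 1)) \<le> 2 * real (s n)"
      using bspec[OF s(2), of n] step.hyps i by force
    \<comment> \<open>The growth bound enters here, as 1/s_n \<le> 2/s_(n+1).\<close>
    have "(real (s (n + 1)) - 2) / s (n + 1) \<le> (real (s n) - 1) / s n"
      using n le by (simp add: field_simps)
    also have "\<dots> < x (n + 1) / s (n + 1)"
    proof -
      have "x n / s n < x (n + 1) / s (n + 1)"
        using x(1) step.hyps i by (simp add: interior_lecture_hall_def)
      then show ?thesis
        using step.IH step.hyps i by simp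
    qed
    finally have "real (s (n + 1)) - 2 < x (n + 1)"
      using n by (simp add: divide_less_cancel)
    then show ?case
      using step squeeze[of "n + 1"] by simp
  qed
qed

theorem theorem2p2:
  fixes s :: "nat \<Rightarrow> nat"
    and P :: "(real ^ 'n::{finite,linorder}) set"
  defines "P \<equiv> lecture_hall_polytope s"
  assumes "\<And>i. i \<in> {1..CARD('n)} \<Longrightarrow> 0 < s i"
    and "strict_mono_on {1..CARD('n)} s"
  shows "((\<exists>Q. fano_polytope Q \<and> translation_equivalent P Q) \<longleftrightarrow>
            s 1 = 2 \<and> (\<forall>i\<in>{1..CARD('n) - 1}. s (i + 1) \<le> 2 * s i)) \<and>
         ((\<exists>Q. fano_polytope Q \<and> translation_equivalent P Q) \<longrightarrow>
            (P - frontier P) \<inter> integer_lattice = {column_point (\<lambda>i. real (s i) - 1)})"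
proof -
  note pos = assms(2) and mono = assms(3)
  have pos_all: "\<forall>i\<in>{1..CARD('n)}. 0 < s i"
    using pos by blast
  let ?p = "\<lambda>i. real (s i) - 1"
  let ?cond = "s 1 = 2 \<and> (\<forall>i\<in>{1..CARD('n) - 1}. s (i + 1) \<le> 2 * s i)"
  have d: "1 \<le> CARD('n)"
    by (simp add: Suc_le_eq)
  \<comment> \<open>This translates interior lattice points into integer sequences satisfying the
    strict inequalities, where the arithmetic lemmas apply.\<close>
  have mem: "column_point x \<in> interior P \<inter> integer_lattice \<longleftrightarrow>
      interior_lecture_hall CARD('n) s x \<and> (\<forall>i\<in>{1..CARD('n)}. x i \<in> \<int>)" for x
    unfolding P_def interior_lecture_hall_polytope[OF pos_all] interior_lecture_hall_def
      column_point_in_integer_lattice_iff Int_iff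
    using d by (simp add: coordinate_column_point)
  have unique: "interior P \<inter> integer_lattice = {column_point ?p}" if ?cond
  proof (rule equalityI)
    show "{column_point ?p} \<subseteq> interior P \<inter> integer_lattice"
      using interior_lecture_hall_pred[OF pos mono d] that mem[of ?p] by simp
    show "interior P \<inter> integer_lattice \<subseteq> {column_point ?p}"
    proof
      fix z assume "z \<in> interior P \<inter> integer_lattice"
      then have "interior_lecture_hall CARD('n) s (coordinate z)"
        "\<forall>i\<in>{1..CARD('n)}. coordinate z i \<in> \<int>"
        using mem[of "coordinate z"] by (simp_all add: column_point_coordinate)
      then have "column_point (coordinate z) = (column_point ?p :: real ^ 'n::_)"
        unfolding column_point_eq_iff
        using interior_lecture_hall_unique[of "CARD('n)" s "coordinate z"] pos that by blast
      then show "z \<in> {column_point ?p}"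
        by (simp add: column_point_coordinate)
    qed
  qed
  have cond: ?cond if p: "interior P \<inter> integer_lattice = {p}" for p
  proof (rule interior_lecture_hall_unique_imp[OF pos mono d])
    have "column_point (coordinate p) \<in> interior P \<inter> integer_lattice"
      using p by (simp add: column_point_coordinate)
    then show "interior_lecture_hall CARD('n) s (coordinate p)"
      "\<And>i. i \<in> {1..CARD('n)} \<Longrightarrow> coordinate p i \<in> \<int>"
      unfolding mem by blast+
    fix y i
    assume "interior_lecture_hall CARD('n) s y" "\<And>i. i \<in> {1..CARD('n)} \<Longrightarrow> y i \<in> \<int>"
      and i: "i \<in> {1..CARD('n)}"
    then have "column_point y = p"
      using mem[of y] p by blast
    then show "y i = coordinate p i"
      using coordinate_column_point[OF i, of y] by simp
  qed
  have lattice: "lattice_polytope P"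
    unfolding P_def by (rule lattice_polytope_lecture_hall[OF pos_all])
  show ?thesis
    \<comment> \<open>For the second claim, a single interior lattice point yields the conditions on
      s through \<open>cond\<close>, and \<open>unique\<close> then identifies the point.\<close>
    unfolding Diff_frontier translation_equivalent_fano_iff[OF lattice] using unique cond by metis
qed

end
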